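(* Let $X$ be a finite indecomposable quandle, $x_0\in X$, and $A$ an abelian group (written additively) with trivial $G_X$-action. Let $N_X=\bigsqcup_{i=0}^k\sigma_iN_0$ be a good decomposition of $N_X$ into $N_0$-cosets. For each $a\in A$ and $g\in\mathrm{Hom}(N_0,A)$, the map $q\colon X\times X\to A$ given by $$q_{x,y}=a+g\bigl(c(x\sigma_yx_0^{-1})\bigr)$$ is a $2$-cocycle of $X$ with values in $A$.
   Context: A rack is a non-empty set $X$ with a binary operation $\triangleright$ such that every map $\varphi_x\colon y\mapsto x\triangleright y$ is bijective and $x\triangleright(y\triangleright z)=(x\triangleright y)\triangleright(x\triangleright z)$ for all $x,y,z$. A quandle is a rack with $x\triangleright x=x$ for all $x$. It is indecomposable if the group $\langle\varphi_x:x\in X\rangle\le \mathbb S_X$ acts transitively on $X$. The enveloping group is $G_X=\langle x\in X: xy=(x\triangleright y)x\rangle$; it acts on $X$ with the generator $x$ acting by $\varphi_x$, and the action is written $g\triangleright y$. Put $N_X=[G_X,G_X]$ and let $N_0$ be the stabilizer of $x_0$ in $N_X$. A decomposition $N_X=\bigsqcup_{i=0}^k\sigma_iN_0$ into left $N_0$-cosets, with chosen representatives $\sigma_i\in N_X$, is good if: (1) $\sigma_0=1$; (2) for each $i$ there is $j$ with $x_0\triangleright\sigma_i=\sigma_j$, where $x_0\triangleright\sigma_i:=x_0\sigma_ix_0^{-1}$ in $G_X$; (3) for each $x\in X$ there is $j$ with $\sigma_j\triangleright x_0=x$. For $n\in N_X$, $\sigma(n)=\sigma_i$ if $n\in\sigma_iN_0$,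 and $c(n)=\sigma(n)^{-1}n\in N_0$. For $y\in X$, $\sigma_y:=\sigma_j$ for the $j$ with $\sigma_j\triangleright x_0=y$. In the formula, $x$ and $x_0$ are regarded as elements of $G_X$; the element $x\sigma_yx_0^{-1}$ lies in $N_X$. A 2-cocycle of $X$ with values in $A$ is a map $q\colon X\times X\to A$ with $q_{x\triangleright y,x\triangleright z}+q_{x,z}=q_{x,y\triangleright z}+q_{y,z}$ for all $x,y,z\in X$. *)

theory Defs
  imports "HOL-Algebra.Generated_Groups" "HOL-Algebra.Group_Action" "HOL-Algebra.Ring"
    "HOL-Library.Disjoint_Sets"
begin

section \<open>Racks and quandles\<close>

definition rack :: "'a set \<Rightarrow> ('a \<Rightarrow> 'a \<Rightarrow> 'a) \<Rightarrow> bool" where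
  "rack X r \<longleftrightarrow> X \<noteq> {} \<and> (\<forall>x\<in>X. bij_betw (r x) X X) \<and>
     (\<forall>x\<in>X. \<forall>y\<in>X. \<forall>z\<in>X. r x (r y z) = r (r x y) (r x z))"

definition quandle :: "'a set \<Rightarrow> ('a \<Rightarrow> 'a \<Rightarrow> 'a) \<Rightarrow> bool" where
  "quandle X r \<longleftrightarrow> rack X r \<and> (\<forall>x\<in>X. r x x = x)"

definition left_perm :: "'a set \<Rightarrow> ('a \<Rightarrow> 'a \<Rightarrow> 'a) \<Rightarrow> 'a \<Rightarrow> ('a \<Rightarrow> 'a)" where
  "left_perm X r x = restrict (r x) X"

definition indecomposable :: "'a set \<Rightarrow> ('a \<Rightarrow> 'a \<Rightarrow> 'a) \<Rightarrow> bool" where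
  "indecomposable X r \<longleftrightarrow>
     (\<forall>x\<in>X. \<forall>y\<in>X. \<exists>f \<in> generate (BijGroup X) (left_perm X r ` X). f x = y)"

definition rack_2_cocycle ::
    "'a set \<Rightarrow> ('a \<Rightarrow> 'a \<Rightarrow> 'a) \<Rightarrow> ('b, 'm) ring_scheme \<Rightarrow> ('a \<Rightarrow> 'a \<Rightarrow> 'b) \<Rightarrow> bool" where
  "rack_2_cocycle X r A q \<longleftrightarrow>
     (\<forall>x\<in>X. \<forall>y\<in>X. q x y \<in> carrier A) \<and>
     (\<forall>x\<in>X. \<forall>y\<in>X. \<forall>z\<in>X.
        q (r x y) (r x z) \<oplus>\<^bsub>A\<^esub> q x z = q x (r y z) \<oplus>\<^bsub>A\<^esub> q y z)"

section \<open>The enveloping group\<close>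

text \<open>
  The presented group is built from words in the generators and their formal inverses:
  \<open>(x, True)\<close> stands for \<open>x\<close> and \<open>(x, False)\<close> for its inverse. Its elements are the classes
  of the least congruence containing the cancellations and the relations of the presentation.
\<close>

definition env_words :: "'a set \<Rightarrow> ('a \<times> bool) list set" where
  "env_words X = lists (X \<times> UNIV)"

inductive_set env_rel :: "'a set \<Rightarrow> ('a \<Rightarrow> 'a \<Rightarrow> 'a) \<Rightarrow> (('a \<times> bool) list \<times> ('a \<times> bool) list) set"
  for X :: "'a set" and r :: "'a \<Rightarrow> 'a \<Rightarrow> 'a" where
  refl: "w \<in> env_words X \<Longrightarrow> (w, w) \<in> env_rel X r"
| sym: "(u, v) \<in> env_rel X r \<Longrightarrow> (v, u) \<in> env_rel X r"
| trans: "(u, v) \<in> env_rel X r \<Longrightarrow> (v, w) \<in> env_rel X r \<Longrightarrow> (u, w) \<in> env_rel X r"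
| append: "(u, u') \<in> env_rel X r \<Longrightarrow> (v, v') \<in> env_rel X r \<Longrightarrow> (u @ v, u' @ v') \<in> env_rel X r"
| cancel: "x \<in> X \<Longrightarrow> ([(x, b), (x, \<not> b)], []) \<in> env_rel X r"
| rack_rel: "x \<in> X \<Longrightarrow> y \<in> X \<Longrightarrow>
    ([(x, True), (y, True)], [(r x y, True), (x, True)]) \<in> env_rel X r"

definition env_group :: "'a set \<Rightarrow> ('a \<Rightarrow> 'a \<Rightarrow> 'a) \<Rightarrow> ('a \<times> bool) list set monoid" where
  "env_group X r =
     \<lparr>carrier = env_words X // env_rel X r,
      mult = (\<lambda>S T. \<Union>u\<in>S. \<Union>v\<in>T. env_rel X r `` {u @ v}),
      one = env_rel X r `` {[]}\<rparr>"

definition env_gen :: "'a set \<Rightarrow> ('a \<Rightarrow> 'a \<Rightarrow> 'a) \<Rightarrow> 'a \<Rightarrow> ('a \<times> bool) list set" where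
  "env_gen X r x = env_rel X r `` {[(x, True)]}"

fun word_perm :: "'a set \<Rightarrow> ('a \<Rightarrow> 'a \<Rightarrow> 'a) \<Rightarrow> ('a \<times> bool) list \<Rightarrow> ('a \<Rightarrow> 'a)" where
  "word_perm X r [] = \<one>\<^bsub>BijGroup X\<^esub>"
| "word_perm X r ((x, b) # w) =
     (if b then left_perm X r x else inv\<^bsub>BijGroup X\<^esub> left_perm X r x)
       \<otimes>\<^bsub>BijGroup X\<^esub> word_perm X r w"

text \<open>
  All words in a class induce the same permutation, so the image below is a singleton; see
  \<open>env_act_class\<close>, \<open>env_act_gen\<close> and \<open>group_action_env\<close> below.
\<close>

definition env_act :: "'a set \<Rightarrow> ('a \<Rightarrow> 'a \<Rightarrow> 'a) \<Rightarrow> ('a \<times> bool) list set \<Rightarrow> ('a \<Rightarrow> 'a)" where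
  "env_act X r g = the_elem (word_perm X r ` g)"

definition env_derived :: "'a set \<Rightarrow> ('a \<Rightarrow> 'a \<Rightarrow> 'a) \<Rightarrow> ('a \<times> bool) list set set" where
  "env_derived X r = derived (env_group X r) (carrier (env_group X r))"

definition env_stab :: "'a set \<Rightarrow> ('a \<Rightarrow> 'a \<Rightarrow> 'a) \<Rightarrow> 'a \<Rightarrow> ('a \<times> bool) list set set" where
  "env_stab X r x0 =
     stabilizer ((env_group X r)\<lparr>carrier := env_derived X r\<rparr>) (env_act X r) x0"

section \<open>Good decompositions\<close>

text \<open>
  The representatives are \<open>\<sigma> 0, \<dots>, \<sigma> k\<close>; values of \<open>\<sigma>\<close> beyond \<open>k\<close> play no role.
\<close>

definition good_decomposition ::
    "'a set \<Rightarrow> ('a \<Rightarrow> 'a \<Rightarrow> 'a) \<Rightarrow> 'a \<Rightarrow> nat \<Rightarrow> (nat \<Rightarrow> ('a \<times> bool) list set) \<Rightarrow> bool" where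
  "good_decomposition X r x0 k \<sigma> \<longleftrightarrow>
     (\<forall>i\<le>k. \<sigma> i \<in> env_derived X r) \<and>
     env_derived X r = (\<Union>i\<le>k. \<sigma> i <#\<^bsub>env_group X r\<^esub> env_stab X r x0) \<and>
     disjoint_family_on (\<lambda>i. \<sigma> i <#\<^bsub>env_group X r\<^esub> env_stab X r x0) {..k} \<and>
     \<sigma> 0 = \<one>\<^bsub>env_group X r\<^esub> \<and>
     (\<forall>i\<le>k. \<exists>j\<le>k. env_gen X r x0 \<otimes>\<^bsub>env_group X r\<^esub> \<sigma> i
          \<otimes>\<^bsub>env_group X r\<^esub> inv\<^bsub>env_group X r\<^esub> env_gen X r x0 = \<sigma> j) \<and>
     (\<forall>x\<in>X. \<exists>j\<le>k. env_act X r (\<sigma> j) x0 = x)"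

text \<open>
  \<open>coset_rep\<close>, \<open>stab_part\<close> and \<open>point_rep\<close> encode \<open>\<sigma>(n)\<close>, \<open>c(n)\<close> and \<open>\<sigma>\<^sub>y\<close>.
  The index in \<open>point_rep\<close> is unique because distinct representatives lie in distinct cosets
  of the stabilizer of \<open>x0\<close>.
\<close>

definition coset_rep ::
    "'a set \<Rightarrow> ('a \<Rightarrow> 'a \<Rightarrow> 'a) \<Rightarrow> 'a \<Rightarrow> nat \<Rightarrow> (nat \<Rightarrow> ('a \<times> bool) list set)
      \<Rightarrow> ('a \<times> bool) list set \<Rightarrow> ('a \<times> bool) list set" where
  "coset_rep X r x0 k \<sigma> n =
     \<sigma> (THE i. i \<le> k \<and> n \<in> \<sigma> i <#\<^bsub>env_group X r\<^esub> env_stab X r x0)"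

definition stab_part ::
    "'a set \<Rightarrow> ('a \<Rightarrow> 'a \<Rightarrow> 'a) \<Rightarrow> 'a \<Rightarrow> nat \<Rightarrow> (nat \<Rightarrow> ('a \<times> bool) list set)
      \<Rightarrow> ('a \<times> bool) list set \<Rightarrow> ('a \<times> bool) list set" where
  "stab_part X r x0 k \<sigma> n =
     inv\<^bsub>env_group X r\<^esub> coset_rep X r x0 k \<sigma> n \<otimes>\<^bsub>env_group X r\<^esub> n"

definition point_rep ::
    "'a set \<Rightarrow> ('a \<Rightarrow> 'a \<Rightarrow> 'a) \<Rightarrow> 'a \<Rightarrow> nat \<Rightarrow> (nat \<Rightarrow> ('a \<times> bool) list set)
      \<Rightarrow> 'a \<Rightarrow> ('a \<times> bool) list set" where
  "point_rep X r x0 k \<sigma> y = \<sigma> (THE j. j \<le> k \<and> env_act X r (\<sigma> j) x0 = y)"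

section \<open>The enveloping group is a group acting on the rack\<close>

lemma rack_closed: "rack X r \<Longrightarrow> x \<in> X \<Longrightarrow> y \<in> X \<Longrightarrow> r x y \<in> X"
  unfolding rack_def by (meson bij_betwE)

lemma env_rel_words:
  assumes "rack X r" "(u, v) \<in> env_rel X r"
  shows "u \<in> env_words X \<and> v \<in> env_words X"
  using assms(2) by (induction) (auto simp: env_words_def rack_closed[OF assms(1)])

lemma equiv_env_rel:
  assumes "rack X r" shows "equiv (env_words X) (env_rel X r)"
proof (rule equivI)
  show "env_rel X r \<subseteq> env_words X \<times> env_words X" using env_rel_words[OF assms] by auto
  show "refl_on (env_words X) (env_rel X r)" by (rule refl_onI) (rule env_rel.refl)
  show "sym (env_rel X r)" by (rule symI) (rule env_rel.sym)
  show "trans (env_rel X r)" by (rule transI) (rule env_rel.trans)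
qed

lemma env_mult_class:
  assumes "rack X r" "u \<in> env_words X" "v \<in> env_words X"
  shows "env_rel X r `` {u} \<otimes>\<^bsub>env_group X r\<^esub> env_rel X r `` {v} = env_rel X r `` {u @ v}"
proof -
  have "env_rel X r `` {u' @ v'} = env_rel X r `` {u @ v}"
    if "(u, u') \<in> env_rel X r" "(v, v') \<in> env_rel X r" for u' v'
    using equiv_class_eq[OF equiv_env_rel[OF assms(1)] env_rel.append[OF that]] by simp
  moreover have "(u, u) \<in> env_rel X r" "(v, v) \<in> env_rel X r"
    using assms by (auto intro: env_rel.refl)
  ultimately have "(\<Union>u'\<in>env_rel X r `` {u}. \<Union>v'\<in>env_rel X r `` {v}. env_rel X r `` {u' @ v'})
      = env_rel X r `` {u @ v}"
    by blast
  then show ?thesis by (simp add: env_group_def)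
qed

lemma env_carrierE:
  assumes "g \<in> carrier (env_group X r)"
  obtains w where "w \<in> env_words X" "g = env_rel X r `` {w}"
  using assms by (auto simp: env_group_def quotient_def)

lemma env_class_in_carrier: "w \<in> env_words X \<Longrightarrow> env_rel X r `` {w} \<in> carrier (env_group X r)"
  by (auto simp: env_group_def quotient_def)

lemma env_left_inverse:
  assumes "rack X r" "w \<in> env_words X"
  shows "\<exists>v\<in>env_words X. (v @ w, []) \<in> env_rel X r"
  using assms(2)
proof (induction w)
  case Nil
  then show ?case by (auto intro!: bexI[of _ "[]"] env_rel.refl)
next
  case (Cons a w)
  obtain x b where a: "a = (x, b)" "x \<in> X" and w: "w \<in> env_words X"
    using Cons.prems by (cases a) (auto simp: env_words_def)
  obtain v where v: "v \<in> env_words X" "(v @ w, []) \<in> env_rel X r" using Cons.IH w by blast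
  have "([(x, \<not> b), (x, b)], []) \<in> env_rel X r" using env_rel.cancel[OF a(2), of "\<not> b"] by simp
  from env_rel.append[OF env_rel.refl[OF v(1)] env_rel.append[OF this env_rel.refl[OF w]]]
  have "((v @ [(x, \<not> b)]) @ a # w, v @ w) \<in> env_rel X r" using a by simp
  moreover have "v @ [(x, \<not> b)] \<in> env_words X" using v a by (auto simp: env_words_def)
  ultimately show ?case using v(2) env_rel.trans by blast
qed

lemma group_env_group:
  assumes "rack X r" shows "group (env_group X r)"
proof (rule groupI)
  note cls = env_mult_class[OF assms]
  have app: "u @ v \<in> env_words X" if "u \<in> env_words X" "v \<in> env_words X" for u v
    using that by (auto simp: env_words_def)
  have nil: "[] \<in> env_words X" by (simp add: env_words_def)
  have one: "\<one>\<^bsub>env_group X r\<^esub> = env_rel X r `` {[]}" by (simp add: env_group_def)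
  show "\<one>\<^bsub>env_group X r\<^esub> \<in> carrier (env_group X r)"
    unfolding one by (rule env_class_in_carrier[OF nil])
  fix g assume "g \<in> carrier (env_group X r)"
  then obtain u where u: "u \<in> env_words X" "g = env_rel X r `` {u}" by (rule env_carrierE)
  show "\<one>\<^bsub>env_group X r\<^esub> \<otimes>\<^bsub>env_group X r\<^esub> g = g"
    unfolding one u(2) using cls[OF nil u(1)] by simp
  obtain v where v: "v \<in> env_words X" "(v @ u, []) \<in> env_rel X r"
    using env_left_inverse[OF assms u(1)] by blast
  show "\<exists>h\<in>carrier (env_group X r). h \<otimes>\<^bsub>env_group X r\<^esub> g = \<one>\<^bsub>env_group X r\<^esub>"
    unfolding one u(2)
    using cls[OF v(1) u(1)] equiv_class_eq[OF equiv_env_rel[OF assms] v(2)] v(1)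
    by (intro bexI[of _ "env_rel X r `` {v}"]) (auto intro: env_class_in_carrier)
  fix h assume "h \<in> carrier (env_group X r)"
  then obtain v where v: "v \<in> env_words X" "h = env_rel X r `` {v}" by (rule env_carrierE)
  show "g \<otimes>\<^bsub>env_group X r\<^esub> h \<in> carrier (env_group X r)"
    unfolding u(2) v(2) cls[OF u(1) v(1)] by (intro env_class_in_carrier app u v)
  fix l assume "l \<in> carrier (env_group X r)"
  then obtain w where w: "w \<in> env_words X" "l = env_rel X r `` {w}" by (rule env_carrierE)
  show "g \<otimes>\<^bsub>env_group X r\<^esub> h \<otimes>\<^bsub>env_group X r\<^esub> l
      = g \<otimes>\<^bsub>env_group X r\<^esub> (h \<otimes>\<^bsub>env_group X r\<^esub> l)"
    unfolding u(2) v(2) w(2) by (simp add: cls u(1) v(1) w(1) app)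
qed

lemma left_perm_Bij: "rack X r \<Longrightarrow> x \<in> X \<Longrightarrow> left_perm X r x \<in> carrier (BijGroup X)"
  by (auto simp: rack_def left_perm_def BijGroup_def Bij_def cong: bij_betw_cong)

lemma word_perm_closed:
  assumes "rack X r" "w \<in> env_words X"
  shows "word_perm X r w \<in> carrier (BijGroup X)"
proof -
  interpret B: group "BijGroup X" by (rule group_BijGroup)
  show ?thesis using assms(2)
    by (induction w) (auto simp: env_words_def left_perm_Bij[OF assms(1)])
qed

lemma word_perm_append:
  assumes "rack X r" "u \<in> env_words X" "v \<in> env_words X"
  shows "word_perm X r (u @ v) = word_perm X r u \<otimes>\<^bsub>BijGroup X\<^esub> word_perm X r v"
proof -
  interpret B: group "BijGroup X" by (rule group_BijGroup)
  note lp = left_perm_Bij[OF assms(1)]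
  show ?thesis using assms(2)
  proof (induction u)
    case Nil
    then show ?case using word_perm_closed[OF assms(1,3)] by simp
  next
    case (Cons p u)
    obtain x b where p: "p = (x, b)" "x \<in> X" and u: "u \<in> env_words X"
      using Cons.prems by (cases p) (auto simp: env_words_def)
    show ?case
      using Cons.IH[OF u] word_perm_closed[OF assms(1) u] word_perm_closed[OF assms(1,3)]
      by (simp add: p lp B.m_assoc)
  qed
qed

lemma left_perm_rack_rel:
  assumes "rack X r" "x \<in> X" "y \<in> X"
  shows "left_perm X r x \<otimes>\<^bsub>BijGroup X\<^esub> left_perm X r y
       = left_perm X r (r x y) \<otimes>\<^bsub>BijGroup X\<^esub> left_perm X r x"
proof -
  have "left_perm X r z \<in> Bij X" if "z \<in> X" for z
    using left_perm_Bij[OF assms(1) that] by (simp add: BijGroup_def)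
  moreover have "r x (r y z) = r (r x y) (r x z)" if "z \<in> X" for z
    using assms that unfolding rack_def by blast
  ultimately show ?thesis
    using assms(2,3) rack_closed[OF assms(1)]
    by (simp add: BijGroup_def compose_def left_perm_def cong: restrict_cong)
qed

lemma word_perm_env_rel:
  assumes "rack X r" "(u, v) \<in> env_rel X r"
  shows "word_perm X r u = word_perm X r v"
proof -
  interpret B: group "BijGroup X" by (rule group_BijGroup)
  note lp = left_perm_Bij[OF assms(1)]
  show ?thesis using assms(2)
  proof induction
    case (append u u' v v')
    then show ?case
      using env_rel_words[OF assms(1)] by (simp add: word_perm_append[OF assms(1)])
  next
    case (cancel x b)
    then show ?case by (auto simp: lp)
  next
    case (rack_rel x y)
    then show ?case
      using left_perm_rack_rel[OF assms(1) rack_rel]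
      by (simp add: lp rack_closed[OF assms(1)])
  qed auto
qed

lemma env_act_class:
  assumes "rack X r" "w \<in> env_words X"
  shows "env_act X r (env_rel X r `` {w}) = word_perm X r w"
proof -
  have "word_perm X r ` (env_rel X r `` {w}) = {word_perm X r w}"
  proof (intro equalityI subsetI)
    fix f assume "f \<in> word_perm X r ` (env_rel X r `` {w})"
    then obtain v where "(w, v) \<in> env_rel X r" "f = word_perm X r v" by blast
    then show "f \<in> {word_perm X r w}" using word_perm_env_rel[OF assms(1), of w v] by simp
  next
    fix f assume "f \<in> {word_perm X r w}"
    then show "f \<in> word_perm X r ` (env_rel X r `` {w})" using env_rel.refl[OF assms(2), of r] by blast
  qed
  then show ?thesis by (simp add: env_act_def)
qed

lemma env_act_gen:
  assumes "rack X r" "x \<in> X" "y \<in> X"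
  shows "env_act X r (env_gen X r x) y = r x y"
proof -
  interpret B: group "BijGroup X" by (rule group_BijGroup)
  have "[(x, True)] \<in> env_words X" using assms by (simp add: env_words_def)
  then show ?thesis
    using assms by (simp add: env_gen_def env_act_class left_perm_Bij) (simp add: left_perm_def)
qed

lemma group_action_env:
  assumes "rack X r" shows "group_action (env_group X r) X (env_act X r)"
proof -
  have "env_act X r \<in> hom (env_group X r) (BijGroup X)"
  proof (rule homI)
    fix g assume "g \<in> carrier (env_group X r)"
    then obtain u where u: "u \<in> env_words X" "g = env_rel X r `` {u}" by (rule env_carrierE)
    show "env_act X r g \<in> carrier (BijGroup X)"
      using u by (simp add: env_act_class[OF assms] word_perm_closed[OF assms])
    fix h assume "h \<in> carrier (env_group X r)"
    then obtain v where v: "v \<in> env_words X" "h = env_rel X r `` {v}" by (rule env_carrierE)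
    have "u @ v \<in> env_words X" using u v by (simp add: env_words_def)
    then show "env_act X r (g \<otimes>\<^bsub>env_group X r\<^esub> h)
        = env_act X r g \<otimes>\<^bsub>BijGroup X\<^esub> env_act X r h"
      using u v by (simp add: env_mult_class[OF assms] env_act_class[OF assms]
          word_perm_append[OF assms])
  qed
  then show ?thesis
    by (simp add: group_action_def group_hom_def group_hom_axioms_def
        group_env_group[OF assms] group_BijGroup)
qed

end

theory Submission
  imports Defs
begin

text \<open>
  Write \<open>x \<triangleright> y\<close> for \<open>r x y\<close>, \<open>b\<close> for the generator of \<open>x0\<close>, and \<open>f(x,y) = c(x \<sigma>\<^sub>y b\<inverse>)\<close>, which is
  \<open>stab_cocycle x y\<close> below. The idea is that, up to the
  factor \<open>b\<close>, \<open>f\<close> is the cocycle of the left multiplication by generators with respect to the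
  section \<open>y \<mapsto> \<sigma>\<^sub>y\<close>, so that the rack cocycle identity for \<open>f\<close> is the defining relation of the
  enveloping group.

  In detail, two elements of the derived subgroup are in the same coset of the stabilizer \<open>N0\<close> iff
  they send \<open>x0\<close> to the same point (\<open>l_coset_stab_iff\<close>). The element \<open>x \<sigma>\<^sub>y b\<inverse>\<close> sends \<open>x0\<close> to
  \<open>x \<triangleright> y\<close>, because \<open>b\<close> fixes \<open>x0\<close> in a quandle. Its coset representative is thus \<open>\<sigma>\<close> at
  \<open>x \<triangleright> y\<close>, which gives \<open>\<sigma>\<^bsub>x\<triangleright>y\<^esub> f(x,y) b = x \<sigma>\<^sub>y\<close> (\<open>cocycle_transport\<close>). Applying this twice,
  \<^item> \<open>x y \<sigma>\<^sub>z = x \<sigma>\<^bsub>y\<triangleright>z\<^esub> f(y,z) b = \<sigma>\<^bsub>x\<triangleright>(y\<triangleright>z)\<^esub> f(x,y\<triangleright>z) b f(y,z) b\<close>, and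
  \<^item> \<open>(x\<triangleright>y) x \<sigma>\<^sub>z = (x\<triangleright>y) \<sigma>\<^bsub>x\<triangleright>z\<^esub> f(x,z) b = \<sigma>\<^bsub>(x\<triangleright>y)\<triangleright>(x\<triangleright>z)\<^esub> f(x\<triangleright>y,x\<triangleright>z) b f(x,z) b\<close>.

  The left-hand sides agree by the relation \<open>x y = (x\<triangleright>y) x\<close>, and the two subscripts of \<open>\<sigma>\<close> on the
  right agree by self-distributivity. The elements of \<open>N0\<close> fix \<open>x0\<close> and hence commute with \<open>b\<close>, by
  the equivariance \<open>env_gen_equivariant\<close> of the generators; so both factors \<open>b\<close> cancel. What remains
  is \<open>f(x\<triangleright>y,x\<triangleright>z) f(x,z) = f(x,y\<triangleright>z) f(y,z)\<close> in \<open>N0\<close>, and the homomorphism \<open>g\<close> turns this into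
  the cocycle identity.
\<close>

section \<open>Generators of the enveloping group\<close>

locale rack_env =
  fixes X :: "'a set" and r :: "'a \<Rightarrow> 'a \<Rightarrow> 'a"
  assumes rack: "rack X r"
begin

abbreviation "G \<equiv> env_group X r"
abbreviation "gen \<equiv> env_gen X r"
abbreviation "act \<equiv> env_act X r"
abbreviation "N \<equiv> env_derived X r"
abbreviation env_times (infixl "\<cdot>" 70) where "g \<cdot> h \<equiv> g \<otimes>\<^bsub>G\<^esub> h"

sublocale group G
  by (rule group_env_group[OF rack])

lemma gen_closed [simp]: "x \<in> X \<Longrightarrow> gen x \<in> carrier G"
  unfolding env_gen_def by (rule env_class_in_carrier) (simp add: env_words_def)

lemma act_closed [simp]: "g \<in> carrier G \<Longrightarrow> x \<in> X \<Longrightarrow> act g x \<in> X"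
  by (rule group_action.element_image[OF group_action_env[OF rack]]) auto

lemma act_mult:
  "g \<in> carrier G \<Longrightarrow> h \<in> carrier G \<Longrightarrow> x \<in> X \<Longrightarrow> act (g \<cdot> h) x = act g (act h x)"
  by (rule group_action.composition_rule[OF group_action_env[OF rack]])

lemma act_one: "x \<in> X \<Longrightarrow> act \<one>\<^bsub>G\<^esub> x = x"
  by (metis group_action.id_eq_one[OF group_action_env[OF rack]] restrict_apply')

lemma act_inv_act: "g \<in> carrier G \<Longrightarrow> x \<in> X \<Longrightarrow> act (inv\<^bsub>G\<^esub> g) (act g x) = x"
  by (metis act_mult act_one inv_closed l_inv)

lemma act_act_inv: "g \<in> carrier G \<Longrightarrow> x \<in> X \<Longrightarrow> act g (act (inv\<^bsub>G\<^esub> g) x) = x"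
  by (metis act_mult act_one inv_closed r_inv)

lemma gen_mult:
  assumes "x \<in> X" "y \<in> X"
  shows "gen x \<cdot> gen y = gen (r x y) \<cdot> gen x"
proof -
  have "r x y \<in> X" using rack assms by (rule rack_closed)
  with assms have "[(z, True)] \<in> env_words X" if "z \<in> {x, y, r x y}" for z
    using that by (auto simp: env_words_def)
  then show ?thesis
    using equiv_class_eq[OF equiv_env_rel[OF rack] env_rel.rack_rel[OF assms]]
    by (simp add: env_gen_def env_mult_class[OF rack])
qed

lemma carrier_eq_generate_gen: "carrier G = generate G (gen ` X)"
proof
  have "env_rel X r `` {w} \<in> generate G (gen ` X)" if "w \<in> env_words X" for w
    using that
  proof (induction w)
    case Nil
    then show ?case using generate.one[of G "gen ` X"] by (simp add: env_group_def)
  next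
    case (Cons p w)
    obtain x b where p: "p = (x, b)" "x \<in> X" and w: "w \<in> env_words X"
      using Cons.prems by (cases p) (auto simp: env_words_def)
    have wd: "[(x, c)] \<in> env_words X" for c
      using p(2) by (simp add: env_words_def)
    have "env_rel X r `` {[(x, False)]} \<cdot> gen x = \<one>\<^bsub>G\<^esub>"
      using equiv_class_eq[OF equiv_env_rel[OF rack] env_rel.cancel[OF p(2), of False]]
      by (simp add: env_gen_def env_mult_class[OF rack wd wd]) (simp add: env_group_def)
    then have "env_rel X r `` {[(x, False)]} = inv\<^bsub>G\<^esub> gen x"
      using p(2) wd by (metis env_class_in_carrier gen_closed inv_equality)
    then have "env_rel X r `` {[p]} \<in> generate G (gen ` X)"
      using p generate.incl[of "gen x" "gen ` X" G] generate.inv[of "gen x" "gen ` X" G]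
      by (cases b) (auto simp: env_gen_def)
    then have "env_rel X r `` {[p]} \<cdot> env_rel X r `` {w} \<in> generate G (gen ` X)"
      using Cons.IH[OF w] by (rule generate.eng)
    then show ?case using env_mult_class[OF rack wd w] p by simp
  qed
  then show "carrier G \<subseteq> generate G (gen ` X)" by (auto elim: env_carrierE)
  show "generate G (gen ` X) \<subseteq> carrier G" by (rule generate_incl) auto
qed

text \<open>
  For a generator this is the relation of the presentation, and it passes to products and inverses
  because \<open>g \<mapsto> act g\<close> is an action.
\<close>

lemma env_gen_equivariant:
  assumes "g \<in> carrier G" "x \<in> X"
  shows "gen (act g x) \<cdot> g = g \<cdot> gen x"
proof -
  have inv_step: "gen (act (inv\<^bsub>G\<^esub> g) x) \<cdot> inv\<^bsub>G\<^esub> g = inv\<^bsub>G\<^esub> g \<cdot> gen x"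
    if g: "g \<in> carrier G" and eq: "\<And>z. z \<in> X \<Longrightarrow> gen (act g z) \<cdot> g = g \<cdot> gen z" and x: "x \<in> X"
    for g x
  proof -
    let ?z = "act (inv\<^bsub>G\<^esub> g) x"
    have z: "?z \<in> X" using g x by simp
    have "gen x \<cdot> g = g \<cdot> gen ?z" using eq[OF z] act_act_inv[OF g x] by simp
    then have "gen ?z = inv\<^bsub>G\<^esub> g \<cdot> (gen x \<cdot> g)"
      using g x z by (metis gen_closed inv_solve_left m_closed)
    then show ?thesis using g x by (simp add: m_assoc)
  qed
  have gens: "gen (act (gen y) x) \<cdot> gen y = gen y \<cdot> gen x" if "y \<in> X" "x \<in> X" for x y
    using that by (simp add: env_act_gen[OF rack] gen_mult)
  have "g \<in> generate G (gen ` X)" using assms(1) carrier_eq_generate_gen by simp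
  then show ?thesis using assms(2)
  proof (induction arbitrary: x rule: generate.induct)
    case one
    then show ?case by (simp add: act_one)
  next
    case (incl h)
    then show ?case using gens by auto
  next
    case (inv h)
    then show ?case using gens inv_step by auto
  next
    case (eng g h)
    then have c: "g \<in> carrier G" "h \<in> carrier G" by (simp_all add: carrier_eq_generate_gen)
    have "gen (act (g \<cdot> h) x) \<cdot> (g \<cdot> h) = gen (act g (act h x)) \<cdot> g \<cdot> h"
      using c eng.prems by (simp add: act_mult m_assoc)
    also have "\<dots> = g \<cdot> (gen (act h x) \<cdot> h)"
      using c eng.prems by (simp add: eng.IH m_assoc)
    also have "\<dots> = g \<cdot> h \<cdot> gen x"
      using c eng.prems by (simp add: eng.IH m_assoc)
    finally show ?case .
  qed
qed

lemma derived_normal: "N \<lhd> G"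
  unfolding env_derived_def by (rule derived_self_is_normal)

lemma derived_in_carrier: "n \<in> N \<Longrightarrow> n \<in> carrier G"
  using normal_imp_subgroup[OF derived_normal] by (rule subgroup.mem_carrier)

lemma derived_mult: "m \<in> N \<Longrightarrow> n \<in> N \<Longrightarrow> m \<cdot> n \<in> N"
  using normal_imp_subgroup[OF derived_normal] by (rule subgroup.m_closed)

lemma derived_inv: "n \<in> N \<Longrightarrow> inv\<^bsub>G\<^esub> n \<in> N"
  using normal_imp_subgroup[OF derived_normal] by (rule subgroup.m_inv_closed)

lemma env_stab_iff: "n \<in> env_stab X r x0 \<longleftrightarrow> n \<in> N \<and> act n x0 = x0"
  by (auto simp: env_stab_def stabilizer_def)

lemma env_stab_commutes_gen:
  assumes "n \<in> env_stab X r x" "x \<in> X"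
  shows "gen x \<cdot> n = n \<cdot> gen x"
  using env_gen_equivariant[of n x] assms by (simp add: env_stab_iff derived_in_carrier)

lemma l_coset_stab_iff:
  assumes "m \<in> N" "n \<in> N" "x \<in> X"
  shows "n \<in> m <#\<^bsub>G\<^esub> env_stab X r x \<longleftrightarrow> act m x = act n x"
proof
  note c = derived_in_carrier[OF assms(1)] derived_in_carrier[OF assms(2)]
  {
    assume "n \<in> m <#\<^bsub>G\<^esub> env_stab X r x"
    then obtain h where "h \<in> env_stab X r x" "n = m \<cdot> h" by (auto simp: l_coset_def)
    then show "act m x = act n x"
      using c assms(3) by (simp add: env_stab_iff derived_in_carrier act_mult)
  next
    assume eq: "act m x = act n x"
    have "inv\<^bsub>G\<^esub> m \<cdot> n \<in> N" using assms by (simp add: derived_mult derived_inv)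
    moreover have "act (inv\<^bsub>G\<^esub> m \<cdot> n) x = x"
      using c assms(3) eq[symmetric] by (simp add: act_mult act_inv_act)
    ultimately have "inv\<^bsub>G\<^esub> m \<cdot> n \<in> env_stab X r x" by (simp add: env_stab_iff)
    moreover have "n = m \<cdot> (inv\<^bsub>G\<^esub> m \<cdot> n)" using c by (simp add: m_assoc[symmetric])
    ultimately show "n \<in> m <#\<^bsub>G\<^esub> env_stab X r x" by (auto simp: l_coset_def)
  }
qed

end

section \<open>Coset representatives indexed by points\<close>

locale good_decomposition_env = rack_env X r
  for X :: "'a set" and r :: "'a \<Rightarrow> 'a \<Rightarrow> 'a" +
  fixes x0 :: 'a and k :: nat and \<sigma> :: "nat \<Rightarrow> ('a \<times> bool) list set"
  assumes quandle: "quandle X r"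
    and x0: "x0 \<in> X"
    and good: "good_decomposition X r x0 k \<sigma>"
begin

abbreviation "N0 \<equiv> env_stab X r x0"
abbreviation "rep \<equiv> point_rep X r x0 k \<sigma>"

definition stab_cocycle :: "'a \<Rightarrow> 'a \<Rightarrow> ('a \<times> bool) list set" where
  "stab_cocycle x y = stab_part X r x0 k \<sigma> (gen x \<cdot> rep y \<cdot> inv\<^bsub>G\<^esub> gen x0)"

lemma sigma_in_derived: "i \<le> k \<Longrightarrow> \<sigma> i \<in> N"
  using good by (auto simp: good_decomposition_def)

lemma sigma_coset_iff:
  "i \<le> k \<Longrightarrow> n \<in> N \<Longrightarrow> n \<in> \<sigma> i <#\<^bsub>G\<^esub> N0 \<longleftrightarrow> act (\<sigma> i) x0 = act n x0"
  by (rule l_coset_stab_iff[OF sigma_in_derived _ x0])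

lemma point_index_unique:
  assumes "y \<in> X"
  shows "\<exists>!j. j \<le> k \<and> act (\<sigma> j) x0 = y"
proof -
  have "\<exists>j\<le>k. act (\<sigma> j) x0 = y" using good assms by (simp add: good_decomposition_def)
  moreover have "i = j"
    if "i \<le> k" "j \<le> k" "act (\<sigma> i) x0 = act (\<sigma> j) x0" for i j
  proof (rule ccontr)
    assume "i \<noteq> j"
    then have "(\<sigma> i <#\<^bsub>G\<^esub> N0) \<inter> (\<sigma> j <#\<^bsub>G\<^esub> N0) = {}"
      using good that by (auto simp: good_decomposition_def disjoint_family_on_def)
    moreover have "\<sigma> j \<in> \<sigma> i <#\<^bsub>G\<^esub> N0" "\<sigma> j \<in> \<sigma> j <#\<^bsub>G\<^esub> N0"
      using that by (simp_all add: sigma_coset_iff sigma_in_derived)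
    ultimately show False by blast
  qed
  ultimately show ?thesis by metis
qed

lemma rep:
  assumes "y \<in> X"
  shows rep_in_derived: "rep y \<in> N" and act_rep: "act (rep y) x0 = y"
  using theI'[OF point_index_unique[OF assms]] sigma_in_derived by (auto simp: point_rep_def)

lemma coset_rep_eq_rep: "n \<in> N \<Longrightarrow> coset_rep X r x0 k \<sigma> n = rep (act n x0)"
  unfolding coset_rep_def point_rep_def using sigma_coset_iff by metis

text \<open>
  The generators are all conjugate under the derived subgroup, \<open>x = \<sigma>\<^sub>x b \<sigma>\<^sub>x\<inverse>\<close>, so that \<open>x b\<inverse>\<close> is
  a commutator.
\<close>

lemma gen_inv_base_in_derived:
  assumes "x \<in> X"
  shows "gen x \<cdot> inv\<^bsub>G\<^esub> gen x0 \<in> N"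
proof -
  note c = derived_in_carrier[OF rep_in_derived[OF assms]]
  have "gen x \<cdot> rep x = rep x \<cdot> gen x0"
    using env_gen_equivariant[OF c x0] act_rep[OF assms] by simp
  then have "gen x = rep x \<cdot> gen x0 \<cdot> inv\<^bsub>G\<^esub> rep x"
    using c assms x0 by (simp add: inv_solve_right)
  then have "gen x \<cdot> inv\<^bsub>G\<^esub> gen x0 = rep x \<cdot> gen x0 \<cdot> inv\<^bsub>G\<^esub> rep x \<cdot> inv\<^bsub>G\<^esub> gen x0"
    by simp
  then show ?thesis
    using c x0 gen_closed[OF x0] unfolding env_derived_def derived_def
    by (simp only:) (rule generate.incl, blast)
qed

lemma cocycle_argument:
  assumes "x \<in> X" "y \<in> X"
  shows cocycle_argument_in_derived: "gen x \<cdot> rep y \<cdot> inv\<^bsub>G\<^esub> gen x0 \<in> N"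
    and act_cocycle_argument: "act (gen x \<cdot> rep y \<cdot> inv\<^bsub>G\<^esub> gen x0) x0 = r x y"
proof -
  note c = derived_in_carrier[OF rep_in_derived[OF assms(2)]]
  have "gen x0 \<cdot> rep y \<cdot> inv\<^bsub>G\<^esub> gen x0 \<in> N"
    using normal.inv_op_closed2[OF derived_normal] rep_in_derived[OF assms(2)] x0 by simp
  then have "gen x \<cdot> inv\<^bsub>G\<^esub> gen x0 \<cdot> (gen x0 \<cdot> rep y \<cdot> inv\<^bsub>G\<^esub> gen x0) \<in> N"
    by (rule derived_mult[OF gen_inv_base_in_derived[OF assms(1)]])
  moreover have "gen x \<cdot> inv\<^bsub>G\<^esub> gen x0 \<cdot> (gen x0 \<cdot> rep y \<cdot> inv\<^bsub>G\<^esub> gen x0)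
      = gen x \<cdot> rep y \<cdot> inv\<^bsub>G\<^esub> gen x0"
    using c assms x0 by (simp add: m_assoc inv_solve_left')
  ultimately show "gen x \<cdot> rep y \<cdot> inv\<^bsub>G\<^esub> gen x0 \<in> N" by simp
  have "act (gen x0) x0 = x0"
    using quandle x0 by (simp add: env_act_gen[OF rack] quandle_def)
  then have "act (inv\<^bsub>G\<^esub> gen x0) x0 = x0" using act_inv_act[of "gen x0" x0] x0 by simp
  then show "act (gen x \<cdot> rep y \<cdot> inv\<^bsub>G\<^esub> gen x0) x0 = r x y"
    using c assms x0 by (simp add: act_mult act_rep env_act_gen[OF rack])
qed

section \<open>The cocycle identity in the stabilizer\<close>

lemma stab_cocycle_eq:
  assumes "x \<in> X" "y \<in> X"
  shows "stab_cocycle x y = inv\<^bsub>G\<^esub> rep (r x y) \<cdot> (gen x \<cdot> rep y \<cdot> inv\<^bsub>G\<^esub> gen x0)"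
  using cocycle_argument[OF assms] by (simp add: stab_cocycle_def stab_part_def coset_rep_eq_rep)

lemma stab_cocycle_in_stab:
  assumes "x \<in> X" "y \<in> X"
  shows "stab_cocycle x y \<in> N0"
proof -
  have xy: "r x y \<in> X" using rack assms by (rule rack_closed)
  note R = rep_in_derived[OF xy] and C = cocycle_argument_in_derived[OF assms]
  have "act (stab_cocycle x y) x0 = act (inv\<^bsub>G\<^esub> rep (r x y)) (r x y)"
    unfolding stab_cocycle_eq[OF assms]
    using derived_in_carrier[OF R] derived_in_carrier[OF C] x0
    by (simp add: act_mult act_cocycle_argument[OF assms])
  also have "\<dots> = x0"
    using act_inv_act[OF derived_in_carrier[OF R] x0] by (simp add: act_rep[OF xy])
  finally show ?thesis
    using R C by (simp add: env_stab_iff) (simp add: stab_cocycle_eq[OF assms] derived_mult derived_inv)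
qed

lemma stab_cocycle_closed: "x \<in> X \<Longrightarrow> y \<in> X \<Longrightarrow> stab_cocycle x y \<in> carrier G"
  using stab_cocycle_in_stab by (simp add: env_stab_iff derived_in_carrier)

lemma cocycle_transport:
  assumes "x \<in> X" "y \<in> X"
  shows "gen x \<cdot> rep y = rep (r x y) \<cdot> stab_cocycle x y \<cdot> gen x0"
proof -
  have xy: "r x y \<in> X" using rack assms by (rule rack_closed)
  note c = derived_in_carrier[OF rep_in_derived[OF xy]]
    derived_in_carrier[OF rep_in_derived[OF assms(2)]]
  have "rep (r x y) \<cdot> stab_cocycle x y = gen x \<cdot> rep y \<cdot> inv\<^bsub>G\<^esub> gen x0"
    unfolding stab_cocycle_eq[OF assms] using c assms x0 by (simp add: m_assoc[symmetric])
  then show ?thesis using c assms x0 by (simp add: m_assoc)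
qed

lemma cocycle_transport2:
  assumes "x \<in> X" "y \<in> X" "z \<in> X"
  shows "gen x \<cdot> gen y \<cdot> rep z
    = rep (r x (r y z)) \<cdot> (stab_cocycle x (r y z) \<cdot> stab_cocycle y z) \<cdot> (gen x0 \<cdot> gen x0)"
proof -
  have yz: "r y z \<in> X" "r x (r y z) \<in> X" using rack_closed[OF rack] assms by auto
  note c = derived_in_carrier[OF rep_in_derived[OF yz(1)]]
    derived_in_carrier[OF rep_in_derived[OF yz(2)]]
    derived_in_carrier[OF rep_in_derived[OF assms(3)]]
    stab_cocycle_closed[OF assms(2,3)] stab_cocycle_closed[OF assms(1) yz(1)]
    gen_closed[OF assms(1)] gen_closed[OF assms(2)] gen_closed[OF x0]
  have "gen x \<cdot> gen y \<cdot> rep z = gen x \<cdot> (gen y \<cdot> rep z)"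
    using c by (simp add: m_assoc)
  also have "\<dots> = gen x \<cdot> rep (r y z) \<cdot> stab_cocycle y z \<cdot> gen x0"
    using c by (simp add: cocycle_transport[OF assms(2,3)] m_assoc)
  also have "\<dots> = rep (r x (r y z)) \<cdot> stab_cocycle x (r y z)
      \<cdot> (gen x0 \<cdot> stab_cocycle y z) \<cdot> gen x0"
    using c by (simp add: cocycle_transport[OF assms(1) yz(1)] m_assoc)
  also have "gen x0 \<cdot> stab_cocycle y z = stab_cocycle y z \<cdot> gen x0"
    by (rule env_stab_commutes_gen[OF stab_cocycle_in_stab[OF assms(2,3)] x0])
  finally show ?thesis using c by (simp add: m_assoc)
qed

lemma stab_cocycle_identity:
  assumes "x \<in> X" "y \<in> X" "z \<in> X"
  shows "stab_cocycle (r x y) (r x z) \<cdot> stab_cocycle x z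
    = stab_cocycle x (r y z) \<cdot> stab_cocycle y z"
proof -
  have cl: "r x y \<in> X" "r x z \<in> X" "r y z \<in> X" "r x (r y z) \<in> X"
    using rack_closed[OF rack] assms by auto
  have "r (r x y) (r x z) = r x (r y z)" using rack assms by (simp add: rack_def)
  then have "rep (r x (r y z)) \<cdot> (stab_cocycle (r x y) (r x z) \<cdot> stab_cocycle x z)
        \<cdot> (gen x0 \<cdot> gen x0)
      = rep (r x (r y z)) \<cdot> (stab_cocycle x (r y z) \<cdot> stab_cocycle y z) \<cdot> (gen x0 \<cdot> gen x0)"
    using cocycle_transport2[OF cl(1) assms(1,3)] cocycle_transport2[OF assms]
    by (simp add: gen_mult[OF assms(1,2)])
  then show ?thesis
    using assms cl x0 derived_in_carrier[OF rep_in_derived[OF cl(4)]]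
    by (simp add: stab_cocycle_closed)
qed

end

theorem theorem1p2:
  fixes X :: "'a set" and r :: "'a \<Rightarrow> 'a \<Rightarrow> 'a" and x0 :: 'a
    and A :: "('b, 'm) ring_scheme"
    and k :: nat and \<sigma> :: "nat \<Rightarrow> ('a \<times> bool) list set"
    and a :: 'b and g :: "('a \<times> bool) list set \<Rightarrow> 'b"
  assumes "finite X" and "quandle X r" and "indecomposable X r" and "x0 \<in> X"
    and "abelian_group A"
    and "good_decomposition X r x0 k \<sigma>"
    and "a \<in> carrier A"
    and "g \<in> hom ((env_group X r)\<lparr>carrier := env_stab X r x0\<rparr>) (add_monoid A)"
  shows "rack_2_cocycle X r A
    (\<lambda>x y. a \<oplus>\<^bsub>A\<^esub> g (stab_part X r x0 k \<sigma>
       (env_gen X r x \<otimes>\<^bsub>env_group X r\<^esub> point_rep X r x0 k \<sigma> y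
          \<otimes>\<^bsub>env_group X r\<^esub> inv\<^bsub>env_group X r\<^esub> env_gen X r x0)))"
proof -
  have rk: "rack X r" using assms(2) by (simp add: quandle_def)
  interpret good_decomposition_env X r x0 k \<sigma>
    using rk assms(2,4,6) by unfold_locales
  interpret A: abelian_group A by (rule assms(5))
  have g_closed: "g n \<in> carrier A" if "n \<in> N0" for n
    using assms(8) that by (auto simp: hom_def)
  have g_mult: "g (m \<cdot> n) = g m \<oplus>\<^bsub>A\<^esub> g n" if "m \<in> N0" "n \<in> N0" for m n
    using assms(8) that by (auto simp: hom_def)
  have "rack_2_cocycle X r A (\<lambda>x y. a \<oplus>\<^bsub>A\<^esub> g (stab_cocycle x y))"
    unfolding rack_2_cocycle_def
  proof (intro conjI ballI)
    fix x y assume "x \<in> X" "y \<in> X"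
    then show "a \<oplus>\<^bsub>A\<^esub> g (stab_cocycle x y) \<in> carrier A"
      using assms(7) by (simp add: g_closed stab_cocycle_in_stab)
  next
    fix x y z assume X: "x \<in> X" "y \<in> X" "z \<in> X"
    then have cl: "r x y \<in> X" "r x z \<in> X" "r y z \<in> X"
      by (auto intro: rack_closed[OF rk])
    note S = stab_cocycle_in_stab[OF cl(1,2)] stab_cocycle_in_stab[OF X(1,3)]
      stab_cocycle_in_stab[OF X(1) cl(3)] stab_cocycle_in_stab[OF X(2,3)]
    have "g (stab_cocycle (r x y) (r x z)) \<oplus>\<^bsub>A\<^esub> g (stab_cocycle x z)
        = g (stab_cocycle x (r y z)) \<oplus>\<^bsub>A\<^esub> g (stab_cocycle y z)"
      using stab_cocycle_identity[OF X] S by (simp flip: g_mult)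
    moreover have "(a \<oplus>\<^bsub>A\<^esub> u) \<oplus>\<^bsub>A\<^esub> (a \<oplus>\<^bsub>A\<^esub> v) = (a \<oplus>\<^bsub>A\<^esub> a) \<oplus>\<^bsub>A\<^esub> (u \<oplus>\<^bsub>A\<^esub> v)"
      if "u \<in> carrier A" "v \<in> carrier A" for u v
      using that assms(7) by (simp add: A.a_ac)
    ultimately show "(a \<oplus>\<^bsub>A\<^esub> g (stab_cocycle (r x y) (r x z))) \<oplus>\<^bsub>A\<^esub> (a \<oplus>\<^bsub>A\<^esub> g (stab_cocycle x z))
        = (a \<oplus>\<^bsub>A\<^esub> g (stab_cocycle x (r y z))) \<oplus>\<^bsub>A\<^esub> (a \<oplus>\<^bsub>A\<^esub> g (stab_cocycle y z))"
      using S by (simp add: g_closed)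
  qed
  then show ?thesis by (simp only: stab_cocycle_def)
qed

end
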